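(* Let $\lambda$ be a real number. The Hausdorff $2$-area integrand of the Finsler metric $$\varphi_\lambda(\mathbf{x},\mathbf{v}) = \frac{(1+\lambda^2\|\mathbf{x}\|^2)\|\mathbf{v}\|^2+\lambda^2\langle \mathbf{x},\mathbf{v}\rangle^2}{\|\mathbf{v}\|}$$ on $\mathbb{R}^3$ is $$\phi_\lambda(\mathbf{x},\mathbf{a})=\frac{2(1+\lambda^2\|\mathbf{x}\|^2)^{3/2}\left((1+2\lambda^2\|\mathbf{x}\|^2)\|\mathbf{a}\|^2-\lambda^2\langle\mathbf{x},\mathbf{a}\rangle^2\right)^{3/2}}{(2+3\lambda^2\|\mathbf{x}\|^2)\|\mathbf{a}\|^2-\lambda^2\langle\mathbf{x},\mathbf{a}\rangle^2}$$ for $\mathbf{x}\in\mathbb{R}^3$ and nonzero $\mathbf{a}\in\Lambda^2\mathbb{R}^3$.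
   Context: $\mathbb{R}^3$ carries its standard inner product $\langle\cdot,\cdot\rangle$ and norm $\|\cdot\|$, with standard basis $\mathbf{e}_1,\mathbf{e}_2,\mathbf{e}_3$; $T\mathbb{R}^3$ is identified with $\mathbb{R}^3\times\mathbb{R}^3\ni(\mathbf{x},\mathbf{v})$. The space $\Lambda^2\mathbb{R}^3$ is identified with $\mathbb{R}^3$ (as Euclidean spaces) by letting $(a_1,a_2,a_3)$ represent the bivector $\mathbf{a}=a_1\,\mathbf{e}_2\wedge\mathbf{e}_3+a_2\,\mathbf{e}_3\wedge\mathbf{e}_1+a_3\,\mathbf{e}_1\wedge\mathbf{e}_2$; this gives meaning to $\|\mathbf{a}\|$ and $\langle\mathbf{x},\mathbf{a}\rangle$. A Minkowski norm on a finite-dimensional real vector space is a norm $\varphi$ that is smooth away from the origin and such that the Hessian of $\varphi^2$ is positive definite at every nonzero point. A Finsler metric on a manifold is a continuous function on the tangent bundle, smooth away from the zero section, whose restriction to each tangent space is a Minkowski norm. Hausdorff $2$-area integrand of a Finsler metric $\varphi$ on $\mathbb{R}^3$: for $\mathbf{x}\in\mathbb{R}^3$ and a nonzero bivector $\mathbf{a}=\mathbf{v}_1\wedge\mathbf{v}_2$ (every bivector in $\mathbb{R}^3$ is simple), let $B_{\mathbf{x}}=\{\mathbf{v}:\varphi(\mathbf{x},\mathbf{v})\le1\}$ and let $\langle\mathbf{a}\rangle$ be the plane spanned by $\mathbf{v}_1,\mathbf{v}_2$. The integrand takes the value $\pi/\mathrm{vol}(B_{\mathbf{x}}\cap\langle\mathbf{a}\rangle;\mathbf{a})$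 at $(\mathbf{x},\mathbf{a})$, where $\mathrm{vol}(\cdot\,;\mathbf{a})$ is the Lebesgue measure on $\langle\mathbf{a}\rangle$ for which the parallelogram spanned by $\mathbf{v}_1,\mathbf{v}_2$ has measure $1$. *)

theory Defs
  imports "HOL-Analysis.Analysis"
begin

section \<open>Smooth functions on open sets\<close>

text \<open>Only meant for open \<open>S\<close>: the derivatives are taken at interior points, and a continuous
  Frechet derivative is equivalent to continuous partial derivatives.\<close>

primrec Ck_on :: "nat \<Rightarrow> 'a::euclidean_space set \<Rightarrow> ('a \<Rightarrow> real) \<Rightarrow> bool" where
  "Ck_on 0 S f \<longleftrightarrow> continuous_on S f"
| "Ck_on (Suc k) S f \<longleftrightarrow>
     (\<forall>x\<in>S. f differentiable at x) \<and>
     (\<forall>b\<in>Basis. Ck_on k S (\<lambda>x. frechet_derivative f (at x) b))"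

definition smooth_on :: "'a::euclidean_space set \<Rightarrow> ('a \<Rightarrow> real) \<Rightarrow> bool" where
  "smooth_on S f \<longleftrightarrow> open S \<and> (\<forall>k. Ck_on k S f)"

section \<open>Minkowski norms and Finsler metrics\<close>

definition is_norm :: "('a::real_vector \<Rightarrow> real) \<Rightarrow> bool" where
  "is_norm f \<longleftrightarrow>
     (\<forall>v. f v \<ge> 0) \<and> (\<forall>v. f v = 0 \<longleftrightarrow> v = 0) \<and>
     (\<forall>c v. f (c *\<^sub>R v) = \<bar>c\<bar> * f v) \<and>
     (\<forall>v w. f (v + w) \<le> f v + f w)"

definition hessian :: "('a::real_normed_vector \<Rightarrow> real) \<Rightarrow> 'a \<Rightarrow> 'a \<Rightarrow> 'a \<Rightarrow> real" where
  "hessian f v w1 w2 =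
     frechet_derivative (\<lambda>u. frechet_derivative f (at u) w1) (at v) w2"

definition minkowski_norm :: "('a::euclidean_space \<Rightarrow> real) \<Rightarrow> bool" where
  "minkowski_norm f \<longleftrightarrow>
     is_norm f \<and> smooth_on (- {0}) f \<and>
     (\<forall>v w. v \<noteq> 0 \<longrightarrow> w \<noteq> 0 \<longrightarrow> hessian (\<lambda>u. (f u)\<^sup>2) v w w > 0)"

text \<open>Finsler metrics on the manifold \<open>'a\<close>, with tangent bundle \<open>'a \<times> 'a\<close> consisting of the
  pairs \<open>(x, v)\<close> of a base point and a tangent vector.\<close>

definition finsler_metric :: "('a::euclidean_space \<times> 'a \<Rightarrow> real) \<Rightarrow> bool" where
  "finsler_metric \<phi> \<longleftrightarrow>
     continuous_on UNIV \<phi> \<and> smooth_on (UNIV \<times> (- {0})) \<phi> \<and>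
     (\<forall>x. minkowski_norm (\<lambda>v. \<phi> (x, v)))"

section \<open>The Hausdorff 2-area integrand\<close>

text \<open>The bivector \<open>a1 e2 \<and> e3 + a2 e3 \<and> e1 + a3 e1 \<and> e2\<close> is represented by the vector
  \<open>(a1, a2, a3)\<close>, so that \<open>v \<and> w\<close> is represented by the cross product \<open>cross3 v w\<close>.

  For linearly independent \<open>v, w\<close>, the Lebesgue measure on the plane spanned by \<open>v, w\<close> for which
  the parallelogram spanned by \<open>v, w\<close> has measure 1 is the image of the Lebesgue measure of the
  coordinate plane under \<open>(s, t) \<mapsto> s v + t w\<close>.\<close>

definition plane_lebesgue :: "real^3 \<Rightarrow> real^3 \<Rightarrow> (real^3) measure" where
  "plane_lebesgue v w =
     distr lborel (restrict_space borel (span {v, w})) (\<lambda>t::real^2. t$1 *\<^sub>R v + t$2 *\<^sub>R w)"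

text \<open>The value does not depend on how the bivector \<open>a \<noteq> 0\<close> is written as \<open>v \<and> w\<close>; this is
  \<open>hausdorff_area_integrand_cross3\<close> below. The value at \<open>a = 0\<close> is irrelevant.\<close>

definition hausdorff_area_integrand ::
    "((real^3) \<times> (real^3) \<Rightarrow> real) \<Rightarrow> real^3 \<Rightarrow> real^3 \<Rightarrow> real" where
  "hausdorff_area_integrand \<phi> x a =
     (THE r. \<forall>v w. cross3 v w = a \<longrightarrow>
        r = pi / measure (plane_lebesgue v w) ({u. \<phi> (x, u) \<le> 1} \<inter> span {v, w}))"

lemma distr_lborel_linear_det_1:
  fixes f :: "real^2 \<Rightarrow> real^2"
  assumes f: "linear f" and det: "\<bar>det (matrix f)\<bar> = 1"
  shows "distr lborel borel f = lborel"
proof (rule lborel_eqI[symmetric])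
  have inv: "invertible (matrix f)"
    using det by (auto simp: invertible_det_nz)
  then obtain B where B: "matrix f ** B = mat 1" "B ** matrix f = mat 1"
    unfolding invertible_def by auto
  have fm: "f x = matrix f *v x" for x
    using matrix_works[of f x] f by (simp add: linear_matrix_vector_mul_eq)
  define g where "g = (\<lambda>x. B *v x)"
  have g: "linear g" unfolding g_def by simp
  have fg: "f (g x) = x" "g (f x) = x" for x
    using fm[of "g x"] fm[of x] unfolding g_def
    by (simp_all only: matrix_vector_mul_assoc B matrix_vector_mul_lid)
  have "det (matrix f) * det B = 1"
    using B(1) by (metis det_mul det_I)
  then have detB: "\<bar>det (matrix g)\<bar> = 1"
    using det unfolding g_def matrix_of_matrix_vector_mul
    by (metis abs_mult abs_one mult_1)
  have fmeas: "f \<in> borel_measurable lborel"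
    using f by (simp add: borel_measurable_continuous_onI linear_continuous_on linear_conv_bounded_linear)
  fix l u :: "real^2"
  assume lu: "\<And>b. b \<in> Basis \<Longrightarrow> l \<bullet> b \<le> u \<bullet> b"
  have vi: "f -` box l u = g ` box l u"
  proof safe
    fix x assume "f x \<in> box l u"
    then have "g (f x) \<in> g ` box l u" by (rule imageI)
    then show "x \<in> g ` box l u" by (simp add: fg)
  qed (simp add: fg)
  have lm: "box l u \<in> lmeasurable" by simp
  have im: "g ` box l u \<in> lmeasurable"
    by (rule measurable_linear_image[OF g lm])
  have "measure lebesgue (g ` box l u) = measure lebesgue (box l u)"
    using measure_linear_image[OF g lm] detB by simp
  then have e: "emeasure lebesgue (g ` box l u) = emeasure lebesgue (box l u)"
    using im lm by (metis emeasure_eq_measure2 fmeasurableD2)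
  have sb: "g ` box l u \<in> sets borel"
    using measurable_sets[OF fmeas, of "box l u"] vi by simp
  have "emeasure (distr lborel borel f) (box l u) = emeasure lborel (g ` box l u)"
    using fmeas by (simp add: emeasure_distr vi)
  also have "\<dots> = emeasure lborel (box l u)"
    using e sb by (simp add: emeasure_completion)
  also have "\<dots> = (\<Prod>b\<in>Basis. (u - l) \<bullet> b)"
    using lu by (simp add: emeasure_lborel_box)
  finally show "emeasure (distr lborel borel f) (box l u) = (\<Prod>b\<in>Basis. (u - l) \<bullet> b)" .
qed simp

lemma cross3_cramer:
  "(cross3 v w \<bullet> cross3 v w) *\<^sub>R u =
     (cross3 u w \<bullet> cross3 v w) *\<^sub>R v + (cross3 v u \<bullet> cross3 v w) *\<^sub>R w
       + (u \<bullet> cross3 v w) *\<^sub>R cross3 v w"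
  by (simp add: cross3_simps forall_3)

lemma cross3_orthogonal_coords:
  assumes "u \<bullet> cross3 v w = 0" and "cross3 v w \<noteq> 0"
  obtains c d where "u = c *\<^sub>R v + d *\<^sub>R w"
proof -
  let ?n = "cross3 v w \<bullet> cross3 v w"
  have "u = (1 / ?n) *\<^sub>R (?n *\<^sub>R u)" using assms(2) by simp
  also have "\<dots> = (1 / ?n) *\<^sub>R ((cross3 u w \<bullet> cross3 v w) *\<^sub>R v + (cross3 v u \<bullet> cross3 v w) *\<^sub>R w)"
    using cross3_cramer[of v w u] assms(1) by simp
  also have "\<dots> = (cross3 u w \<bullet> cross3 v w / ?n) *\<^sub>R v + (cross3 v u \<bullet> cross3 v w / ?n) *\<^sub>R w"
    by (simp add: scaleR_right_distrib)
  finally show ?thesis by (rule that)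
qed

lemma span_cross3:
  assumes "cross3 v w \<noteq> 0"
  shows "span {v, w} = {u. u \<bullet> cross3 v w = 0}"
proof -
  have "u \<in> span {v, w} \<longleftrightarrow> (\<exists>c d. u = c *\<^sub>R v + d *\<^sub>R w)" for u
    by (auto simp: span_insert algebra_simps span_singleton)
  then show ?thesis
    using cross3_orthogonal_coords[OF _ assms]
    by (auto simp: inner_add_left dot_cross_self) metis
qed

lemma plane_lebesgue_cong:
  assumes eq: "cross3 v w = cross3 v' w'" and nz: "cross3 v w \<noteq> 0"
  shows "plane_lebesgue v w = plane_lebesgue v' w'"
proof -
  have sp: "span {v', w'} = span {v, w}"
    using span_cross3[of v w] span_cross3[of v' w'] eq nz by simp
  obtain a b where v': "v' = a *\<^sub>R v + b *\<^sub>R w"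
    using cross3_orthogonal_coords[of v' v w] eq nz by (metis dot_cross_self(1))
  obtain c d where w': "w' = c *\<^sub>R v + d *\<^sub>R w"
    using cross3_orthogonal_coords[of w' v w] eq nz by (metis dot_cross_self(2))
  have "cross3 v' w' = (a * d - b * c) *\<^sub>R cross3 v w"
    unfolding v' w' by (simp add: cross3_simps forall_3)
  then have det: "a * d - b * c = 1"
    using eq nz by (metis scaleR_cancel_right scaleR_one)
  define f :: "real^2 \<Rightarrow> real^2"
    where "f = (\<lambda>t. vector [t$1 * a + t$2 * c, t$1 * b + t$2 * d])"
  have f: "linear f"
    unfolding f_def by (rule linearI) (simp_all add: vec_eq_iff forall_2 algebra_simps)
  have "det (matrix f) = 1"
    using det by (simp add: det_2 matrix_def f_def axis_def mult.commute)
  then have lb: "distr lborel borel f = lborel"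
    using distr_lborel_linear_det_1[OF f] by simp
  let ?g = "\<lambda>v w (t::real^2). t$1 *\<^sub>R v + t$2 *\<^sub>R w"
  let ?N = "restrict_space borel (span {v, w})"
  have "?g v w t \<in> span {v, w}" for t
    by (intro span_add span_scale span_base) auto
  moreover have "?g v w \<in> borel_measurable borel"
    by (intro borel_measurable_continuous_onI continuous_intros)
  ultimately have gm: "?g v w \<in> borel \<rightarrow>\<^sub>M ?N"
    by (intro measurable_restrict_space2) auto
  have fm: "f \<in> lborel \<rightarrow>\<^sub>M borel"
    using f by (simp add: borel_measurable_continuous_onI linear_continuous_on linear_conv_bounded_linear)
  have "?g v' w' = ?g v w \<circ> f"
    by (simp add: fun_eq_iff f_def v' w' algebra_simps)
  then have "distr lborel ?N (?g v' w') = distr (distr lborel borel f) ?N (?g v w)"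
    using distr_distr[OF gm fm] by simp
  then show ?thesis
    unfolding plane_lebesgue_def sp lb by simp
qed

lemma hausdorff_area_integrand_cross3:
  assumes "cross3 v w \<noteq> 0"
  shows "hausdorff_area_integrand \<phi> x (cross3 v w) =
           pi / measure (plane_lebesgue v w) ({u. \<phi> (x, u) \<le> 1} \<inter> span {v, w})"
  unfolding hausdorff_area_integrand_def
proof (rule the_equality)
  show "\<forall>v' w'. cross3 v' w' = cross3 v w \<longrightarrow>
      pi / measure (plane_lebesgue v w) ({u. \<phi> (x, u) \<le> 1} \<inter> span {v, w}) =
      pi / measure (plane_lebesgue v' w') ({u. \<phi> (x, u) \<le> 1} \<inter> span {v', w'})"
    using plane_lebesgue_cong[of v w] span_cross3 assms by metis
qed blast

section \<open>The metrics\<close>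

text \<open>The value at \<open>v = 0\<close> is 0, by division by zero.\<close>

definition phi_metric :: "real \<Rightarrow> (real^3) \<times> (real^3) \<Rightarrow> real" where
  "phi_metric lam = (\<lambda>(x, v).
     ((1 + lam\<^sup>2 * (norm x)\<^sup>2) * (norm v)\<^sup>2 + lam\<^sup>2 * (x \<bullet> v)\<^sup>2) / norm v)"

end

theory Submission
  imports Defs
begin

text \<open>For \<open>v \<noteq> 0\<close> the convexity of the metric and the positivity of the Hessian of its square come from
  sum-of-squares identities, where \<open>\<langle>x, v\<rangle>\<^sup>2 \<le> \<parallel>x\<parallel>\<^sup>2\<parallel>v\<parallel>\<^sup>2\<close> makes all terms nonnegative.

  For the area integrand, take an orthonormal basis \<open>e1, e2\<close> of the plane orthogonal to \<open>a\<close> such that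
  \<open>x\<close> is orthogonal to \<open>e2\<close>. In these coordinates the unit disc is
  \<open>{(s, t). P (s\<^sup>2 + t\<^sup>2) + Q s\<^sup>2 \<le> sqrt (s\<^sup>2 + t\<^sup>2)}\<close>, and the substitution \<open>t = s u\<close> turns its area
  into the integral of \<open>(1 + u\<^sup>2) / (P + Q + P u\<^sup>2)\<^sup>2\<close> over the real line.\<close>

section \<open>The Finsler condition\<close>

lemma Ck_on_cong:
  assumes "open S" and "\<And>x. x \<in> S \<Longrightarrow> f x = g x"
  shows "Ck_on k S f \<longleftrightarrow> Ck_on k S g"
  using assms(2)
proof (induction k arbitrary: f g)
  case 0
  then show ?case by (simp cong: continuous_on_cong)
next
  case (Suc k)
  \<comment> \<open>Since \<open>S\<close> is open, agreement on \<open>S\<close> is agreement near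
    each of its points, and that determines the derivatives.\<close>
  have hd: "(f has_derivative D) (at x) \<longleftrightarrow> (g has_derivative D) (at x)" if "x \<in> S" for x D
    using that Suc.prems assms(1) has_derivative_transform_within_open[of _ _ x UNIV S]
    by metis
  have "f differentiable at x \<longleftrightarrow> g differentiable at x" if "x \<in> S" for x
    using hd[OF that] by (simp add: differentiable_def)
  moreover have "Ck_on k S (\<lambda>x. frechet_derivative f (at x) b) \<longleftrightarrow>
      Ck_on k S (\<lambda>x. frechet_derivative g (at x) b)" for b
    by (rule Suc.IH) (simp add: frechet_derivative_def hd)
  ultimately show ?case by simp
qed

text \<open>Induction on the order: membership in \<open>C\<close> yields continuity, and the
  directional derivatives lie in \<open>C\<close> again. \<open>Ck_on_cong\<close> is needed because
  \<open>frechet_derivative\<close> is known to equal \<open>f'\<close> only on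
  \<open>S\<close>.\<close>

lemma smooth_on_closed_class:
  assumes "open S" and "C f"
    and closed: "\<And>f. C f \<Longrightarrow> \<exists>f'. (\<forall>x\<in>S. (f has_derivative f' x) (at x)) \<and> (\<forall>b. C (\<lambda>x. f' x b))"
  shows "smooth_on S f"
proof -
  have "Ck_on k S f" if "C f" for k f
    using that
  proof (induction k arbitrary: f)
    case 0
    then show ?case using closed[OF 0]
      by (metis Ck_on.simps(1) continuous_at_imp_continuous_on has_derivative_continuous)
  next
    case (Suc k)
    obtain f' where f': "\<And>x. x \<in> S \<Longrightarrow> (f has_derivative f' x) (at x)" "\<And>b. C (\<lambda>x. f' x b)"
      using closed[OF Suc.prems] by blast
    have "Ck_on k S (\<lambda>x. frechet_derivative f (at x) b)" for b
      using Suc.IH[OF f'(2)[of b]]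
      by (subst Ck_on_cong[OF \<open>open S\<close>, of _ "\<lambda>x. f' x b"])
        (simp_all add: frechet_derivative_at[OF f'(1), symmetric])
    then show ?case using f'(1) by (auto simp: differentiable_def)
  qed
  then show ?thesis using assms by (simp add: smooth_on_def)
qed

text \<open>A class of functions that contains the metrics and is closed under differentiation on
  \<open>{y. L y \<noteq> 0}\<close>, whence its members are smooth there.\<close>

inductive norm_algebra :: "('a::euclidean_space \<Rightarrow> 'b::real_inner) \<Rightarrow> ('a \<Rightarrow> real) \<Rightarrow> bool"
  for L where
  const: "norm_algebra L (\<lambda>_. c)"
| linear: "bounded_linear f \<Longrightarrow> norm_algebra L f"
| inner: "bounded_linear (M :: 'a \<Rightarrow> 'b) \<Longrightarrow> bounded_linear N \<Longrightarrow> norm_algebra L (\<lambda>y. M y \<bullet> N y)"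
| inverse_norm: "norm_algebra L (\<lambda>y. inverse (norm (L y)))"
| add: "norm_algebra L f \<Longrightarrow> norm_algebra L g \<Longrightarrow> norm_algebra L (\<lambda>y. f y + g y)"
| mult: "norm_algebra L f \<Longrightarrow> norm_algebra L g \<Longrightarrow> norm_algebra L (\<lambda>y. f y * g y)"

lemma norm_algebra_power: "norm_algebra L f \<Longrightarrow> norm_algebra L (\<lambda>y. f y ^ n)"
  by (induction n) (auto intro: norm_algebra.intros)

text \<open>By rule induction every member has a derivative whose values in fixed directions are
  again members. Only the generator \<open>inverse (norm (L y))\<close> depends on
  \<open>L y\<close> being nonzero.\<close>

lemma norm_algebra_smooth_on:
  assumes L: "bounded_linear L" and "norm_algebra L f"
  shows "smooth_on {y. L y \<noteq> 0} f"
proof (rule smooth_on_closed_class[of _ "norm_algebra L"])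
  have "open (L -` (- {0}))"
    using L by (intro continuous_open_vimage) (auto simp: linear_continuous_at)
  then show "open {y. L y \<noteq> 0}" by (simp add: vimage_def)
next
  fix f assume "norm_algebra L f"
  then show "\<exists>f'. (\<forall>y\<in>{y. L y \<noteq> 0}. (f has_derivative f' y) (at y)) \<and>
      (\<forall>b. norm_algebra L (\<lambda>y. f' y b))"
  proof induction
    case (const c)
    then show ?case
      by (intro exI[of _ "\<lambda>_ _. 0"]) (auto intro: norm_algebra.intros)
  next
    case (linear f)
    then show ?case
      by (intro exI[of _ "\<lambda>_. f"]) (auto intro: norm_algebra.intros bounded_linear_imp_has_derivative)
  next
    case (inner M N)
    \<comment> \<open>For a fixed direction \<open>b\<close> both summands are linear in
      \<open>y\<close>.\<close>
    have "norm_algebra L (\<lambda>y. M y \<bullet> N b + M b \<bullet> N y)" for b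
      using inner by (intro norm_algebra.intros(5) norm_algebra.linear)
        (auto intro: bounded_linear_inner_left_comp bounded_linear_inner_right_comp)
    then show ?case using inner
      by (intro exI[of _ "\<lambda>y h. M y \<bullet> N h + M h \<bullet> N y"])
        (auto intro!: has_derivative_inner bounded_linear_imp_has_derivative)
  next
    case inverse_norm
    \<comment> \<open>In a fixed direction this is a linear function times the cube of the generator
      itself.\<close>
    let ?f' = "\<lambda>y h. (- (L y \<bullet> L h)) * inverse (norm (L y)) ^ 3"
    have "((\<lambda>y. inverse (norm (L y))) has_derivative ?f' y) (at y)" if "L y \<noteq> 0" for y
    proof -
      have "((\<lambda>y. norm (L y)) has_derivative (\<lambda>h. L h \<bullet> sgn (L y))) (at y)"
        using has_derivative_compose[OF bounded_linear_imp_has_derivative[OF L] has_derivative_norm] that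
        by simp
      from Deriv.has_derivative_inverse[OF _ this] that show ?thesis
        by (simp add: sgn_div_norm field_simps power3_eq_cube inner_commute)
    qed
    moreover have "norm_algebra L (\<lambda>y. ?f' y b)" for b
    proof (intro norm_algebra.mult norm_algebra_power norm_algebra.inverse_norm)
      show "norm_algebra L (\<lambda>y. - (L y \<bullet> L b))"
        using L by (intro norm_algebra.linear bounded_linear_minus bounded_linear_inner_left_comp)
    qed
    ultimately show ?case by (intro exI[of _ ?f']) auto
  next
    case (add f g)
    then obtain f' g' where
      *: "\<forall>y\<in>{y. L y \<noteq> 0}. (f has_derivative f' y) (at y)" "\<forall>b. norm_algebra L (\<lambda>y. f' y b)"
      "\<forall>y\<in>{y. L y \<noteq> 0}. (g has_derivative g' y) (at y)" "\<forall>b. norm_algebra L (\<lambda>y. g' y b)"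
      by blast
    then show ?case
      by (intro exI[of _ "\<lambda>y h. f' y h + g' y h"]) (auto intro: has_derivative_add norm_algebra.add)
  next
    case (mult f g)
    then obtain f' g' where
      *: "\<forall>y\<in>{y. L y \<noteq> 0}. (f has_derivative f' y) (at y)" "\<forall>b. norm_algebra L (\<lambda>y. f' y b)"
      "\<forall>y\<in>{y. L y \<noteq> 0}. (g has_derivative g' y) (at y)" "\<forall>b. norm_algebra L (\<lambda>y. g' y b)"
      by blast
    then show ?case using mult.hyps
      by (intro exI[of _ "\<lambda>y h. f y * g' y h + f' y h * g y"])
        (auto intro!: has_derivative_mult norm_algebra.add norm_algebra.mult)
  qed
qed fact

text \<open>Off the zero section the quotient is continuous. On it the value is 0, and
  Cauchy-Schwarz squeezes the metric between 0 and
  \<open>(1 + 2 * lam^2 * norm x ^ 2) * norm v\<close>.\<close>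

lemma continuous_on_phi_metric: "continuous_on UNIV (phi_metric lam)"
proof (rule continuous_at_imp_continuous_on, rule ballI)
  fix z :: "(real^3) \<times> (real^3)"
  obtain x v where z: "z = (x, v)" by fastforce
  show "isCont (phi_metric lam) z"
  proof (cases "v = 0")
    case False
    then show ?thesis unfolding z phi_metric_def case_prod_beta
      by (intro continuous_intros) auto
  next
    case True
    let ?u = "\<lambda>z::(real^3) \<times> (real^3). (1 + 2 * lam\<^sup>2 * (norm (fst z))\<^sup>2) * norm (snd z)"
    have "isCont ?u z" by (intro continuous_intros)
    then have u: "(?u \<longlongrightarrow> 0) (at z)" using True z by (simp add: isCont_def)
    have "norm (phi_metric lam y) \<le> ?u y" for y
    proof (cases "snd y = 0")
      case False
      have "(fst y \<bullet> snd y)\<^sup>2 \<le> (norm (fst y))\<^sup>2 * (norm (snd y))\<^sup>2"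
        using Cauchy_Schwarz_ineq[of "fst y" "snd y"] by (simp add: power2_norm_eq_inner)
      then have "lam\<^sup>2 * (fst y \<bullet> snd y)\<^sup>2 \<le> lam\<^sup>2 * ((norm (fst y))\<^sup>2 * (norm (snd y))\<^sup>2)"
        by (rule mult_left_mono) simp
      then have "(1 + lam\<^sup>2 * (norm (fst y))\<^sup>2) * (norm (snd y))\<^sup>2 + lam\<^sup>2 * (fst y \<bullet> snd y)\<^sup>2
          \<le> ?u y * norm (snd y)"
        by (simp add: algebra_simps power2_eq_square)
      then show ?thesis using False
        by (simp add: phi_metric_def case_prod_beta pos_divide_le_eq)
    qed (simp add: phi_metric_def case_prod_beta)
    then have "(phi_metric lam \<longlongrightarrow> 0) (at z)"
      by (intro Lim_null_comparison[OF _ u]) auto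
    then show ?thesis using True z by (simp add: isCont_def phi_metric_def)
  qed
qed

text \<open>With \<open>L = snd\<close> the set where \<open>L\<close> does not vanish is the
  complement of the zero section, and the numerator is a polynomial in inner products of
  \<open>fst z\<close> and \<open>snd z\<close>.\<close>

lemma smooth_on_phi_metric: "smooth_on (UNIV \<times> (- {0})) (phi_metric lam)"
proof -
  have "norm_algebra snd (\<lambda>z::(real^3) \<times> (real^3).
      ((1 + lam\<^sup>2 * (fst z \<bullet> fst z)) * (snd z \<bullet> snd z) + lam\<^sup>2 * (fst z \<bullet> snd z)\<^sup>2)
        * inverse (norm (snd z)))"
    by (intro norm_algebra_power norm_algebra.add norm_algebra.mult norm_algebra.const
        norm_algebra.inner norm_algebra.inverse_norm bounded_linear_fst bounded_linear_snd)
  moreover have "UNIV \<times> (- {0}) = {z::(real^3) \<times> (real^3). snd z \<noteq> 0}"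
    by auto
  ultimately show ?thesis
    using norm_algebra_smooth_on[OF bounded_linear_snd]
    by (simp only: phi_metric_def case_prod_beta' power2_norm_eq_inner divide_inverse)
qed

lemma smooth_on_phi_metric_fibre: "smooth_on (- {0}) (\<lambda>v. phi_metric lam (x, v))"
proof -
  have "norm_algebra (\<lambda>v::real^3. v) (\<lambda>v::real^3.
      ((1 + lam\<^sup>2 * (norm x)\<^sup>2) * (v \<bullet> v) + lam\<^sup>2 * (x \<bullet> v)\<^sup>2) * inverse (norm v))"
    by (intro norm_algebra_power norm_algebra.add norm_algebra.mult norm_algebra.const
        norm_algebra.inner norm_algebra.inverse_norm norm_algebra.linear bounded_linear_ident
        bounded_linear_inner_right)
  from norm_algebra_smooth_on[OF bounded_linear_ident this] show ?thesis
    by (simp add: phi_metric_def power2_norm_eq_inner divide_inverse Compl_eq)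
qed

section \<open>The norm axioms on each tangent space\<close>

lemma power2_inner_le: "(x \<bullet> v)\<^sup>2 \<le> (norm x)\<^sup>2 * (norm v)\<^sup>2" for x v :: "'a::real_inner"
  using Cauchy_Schwarz_ineq[of x v] by (simp add: power2_norm_eq_inner)

text \<open>The differential of the metric at \<open>v\<close>. The triangle inequality follows from \<open>dphi \<le> \<phi>\<close>, with
  equality at \<open>v\<close>.\<close>

definition dphi :: "real \<Rightarrow> real^3 \<Rightarrow> real^3 \<Rightarrow> real^3 \<Rightarrow> real" where
  "dphi lam x v w =
     (1 + lam\<^sup>2 * (norm x)\<^sup>2) * (v \<bullet> w) / norm v
     + lam\<^sup>2 * (2 * (x \<bullet> v) * (x \<bullet> w) / norm v - (x \<bullet> v)\<^sup>2 * (v \<bullet> w) / (norm v) ^ 3)"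

lemma dphi_self: "v \<noteq> 0 \<Longrightarrow> dphi lam x v v = phi_metric lam (x, v)"
  unfolding dphi_def phi_metric_def
  by (simp add: dot_square_norm field_simps power2_eq_square power3_eq_cube)

lemma dphi_add: "dphi lam x v (w + w') = dphi lam x v w + dphi lam x v w'"
  unfolding dphi_def by (simp add: inner_right_distrib algebra_simps add_divide_distrib)

text \<open>After normalising \<open>v\<close> and \<open>w\<close>, the difference of the two sides
  is \<open>norm w\<close> times a sum of nonnegative terms: \<open>c\<close> is the cosine of the
  angle between \<open>v\<close> and \<open>w\<close>, \<open>a\<close> and \<open>b\<close> are the
  components of \<open>x\<close> along them, and \<open>a^2\<close> is at most
  \<open>s\<close>.\<close>

lemma dphi_le_phi_metric:
  assumes "v \<noteq> 0"
  shows "dphi lam x v w \<le> phi_metric lam (x, w)"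
proof (cases "w = 0")
  case True
  then show ?thesis by (simp add: dphi_def phi_metric_def)
next
  case False
  define m n where mn: "m = norm v" "n = norm w"
  have pos: "m > 0" "n > 0" using False assms mn by auto
  define a b c s where abcs: "a = (x \<bullet> v) / m" "b = (x \<bullet> w) / n" "c = (v \<bullet> w) / (m * n)" "s = (norm x)\<^sup>2"
  have eqs: "x \<bullet> v = a * m" "x \<bullet> w = b * n" "v \<bullet> w = c * m * n"
    using pos abcs by auto
  have c: "c \<le> 1"
    using norm_cauchy_schwarz[of v w] pos mn unfolding abcs by (simp add: pos_divide_le_eq)
  have a: "a\<^sup>2 \<le> s"
    using power2_inner_le[of x v] pos mn unfolding abcs by (simp add: power_divide pos_divide_le_eq)
  have "phi_metric lam (x, w) - dphi lam x v w
      = n * ((1 + lam\<^sup>2 * s) * (1 - c) + lam\<^sup>2 * (b\<^sup>2 - 2 * a * b + a\<^sup>2 * c))"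
    using pos unfolding phi_metric_def dphi_def prod.case eqs mn[symmetric] abcs(4)[symmetric]
    by (simp add: field_simps power2_eq_square power3_eq_cube)
  also have "\<dots> = n * ((1 - c) + lam\<^sup>2 * ((s - a\<^sup>2) * (1 - c) + (a - b)\<^sup>2))"
    by (simp add: algebra_simps power2_eq_square)
  also have "\<dots> \<ge> 0"
    using pos a c by (intro mult_nonneg_nonneg add_nonneg_nonneg) auto
  finally show ?thesis by simp
qed

lemma phi_metric_nonneg: "phi_metric lam (x, v) \<ge> 0"
  by (simp add: phi_metric_def)

lemma phi_metric_eq_0_iff: "phi_metric lam (x, v) = 0 \<longleftrightarrow> v = 0"
proof -
  have "(1 + lam\<^sup>2 * (norm x)\<^sup>2) * (norm v)\<^sup>2 + lam\<^sup>2 * (x \<bullet> v)\<^sup>2 > 0" if "v \<noteq> 0"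
    using that by (intro add_pos_nonneg mult_pos_pos) (auto intro: add_pos_nonneg)
  then show ?thesis by (cases "v = 0") (force simp: phi_metric_def)+
qed

lemma phi_metric_scaleR: "phi_metric lam (x, c *\<^sub>R v) = \<bar>c\<bar> * phi_metric lam (x, v)"
proof (cases "c = 0")
  case False
  have "phi_metric lam (x, c *\<^sub>R v)
      = \<bar>c\<bar>\<^sup>2 * ((1 + lam\<^sup>2 * (norm x)\<^sup>2) * (norm v)\<^sup>2 + lam\<^sup>2 * (x \<bullet> v)\<^sup>2) / (\<bar>c\<bar> * norm v)"
    by (simp add: phi_metric_def power_mult_distrib algebra_simps)
  also have "\<dots> = \<bar>c\<bar> * phi_metric lam (x, v)"
    using False unfolding power2_eq_square[of "\<bar>c\<bar>"]
    by (simp add: phi_metric_def del: abs_mult_self_eq)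
  finally show ?thesis .
qed (simp add: phi_metric_def)

lemma is_norm_phi_metric: "is_norm (\<lambda>v. phi_metric lam (x, v))"
proof -
  have "phi_metric lam (x, v + w) \<le> phi_metric lam (x, v) + phi_metric lam (x, w)" for v w
  proof (cases "v + w = 0")
    case True
    then show ?thesis by (metis add_nonneg_nonneg phi_metric_eq_0_iff phi_metric_nonneg)
  next
    case False
    \<comment> \<open>At the base point \<open>v + w\<close> the differential reproduces the metric
      of \<open>v + w\<close>, splits additively into its values at \<open>v\<close> and
      \<open>w\<close>, and each value is bounded by the metric.\<close>
    then show ?thesis
      using dphi_le_phi_metric[of "v + w" lam x v] dphi_le_phi_metric[of "v + w" lam x w]
        dphi_self[of "v + w" lam x] dphi_add[of lam x "v + w" v w] by linarith
  qed
  then show ?thesis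
    by (simp add: is_norm_def phi_metric_nonneg phi_metric_eq_0_iff phi_metric_scaleR)
qed

section \<open>The Hessian of the squared metric\<close>

text \<open>Squaring removes the odd powers of \<open>norm v\<close>, leaving a rational expression
  in inner products that is easy to differentiate. At \<open>v = 0\<close> both sides are 0 by
  division by zero.\<close>

lemma phi_metric_sq:
  "(phi_metric lam (x, v))\<^sup>2 = (1 + lam\<^sup>2 * (norm x)\<^sup>2)\<^sup>2 * (v \<bullet> v)
     + 2 * (1 + lam\<^sup>2 * (norm x)\<^sup>2) * lam\<^sup>2 * (x \<bullet> v)\<^sup>2 + lam ^ 4 * (x \<bullet> v) ^ 4 / (v \<bullet> v)"
proof (cases "v = 0")
  case False
  then show ?thesis unfolding phi_metric_def
    by (simp add: dot_square_norm field_simps power2_eq_square power4_eq_xxxx)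
qed (simp add: phi_metric_def)

lemma hessian_phi_metric_sq:
  assumes "v \<noteq> 0"
  shows "hessian (\<lambda>u. (phi_metric lam (x, u))\<^sup>2) v w w =
    2 * (1 + lam\<^sup>2 * (norm x)\<^sup>2)\<^sup>2 * (w \<bullet> w) + 4 * (1 + lam\<^sup>2 * (norm x)\<^sup>2) * lam\<^sup>2 * (x \<bullet> w)\<^sup>2
    + lam ^ 4 * (12 * (x \<bullet> v)\<^sup>2 * (x \<bullet> w)\<^sup>2 / (v \<bullet> v)
       - 16 * (x \<bullet> v) ^ 3 * (x \<bullet> w) * (v \<bullet> w) / (v \<bullet> v)\<^sup>2
       + 8 * (x \<bullet> v) ^ 4 * (v \<bullet> w)\<^sup>2 / (v \<bullet> v) ^ 3 - 2 * (x \<bullet> v) ^ 4 * (w \<bullet> w) / (v \<bullet> v)\<^sup>2)"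
proof -
  define p where "p = 1 + lam\<^sup>2 * (norm x)\<^sup>2"
  let ?F = "\<lambda>u. (phi_metric lam (x, u))\<^sup>2"
  \<comment> \<open>\<open>?D u\<close> is the differential of \<open>?F\<close> at
    \<open>u\<close>, and \<open>?H\<close> below is the differential of \<open>?D u w\<close> in
    \<open>u\<close> at \<open>v\<close>. For \<open>h = w\<close> the two mixed terms of
    \<open>?H\<close> coincide, whence the coefficient 16.\<close>
  let ?D = "\<lambda>u h. 2 * p\<^sup>2 * (u \<bullet> h) + 4 * p * lam\<^sup>2 * (x \<bullet> u) * (x \<bullet> h)
    + lam ^ 4 * (4 * (x \<bullet> u) ^ 3 * (x \<bullet> h) / (u \<bullet> u) - 2 * (x \<bullet> u) ^ 4 * (u \<bullet> h) / (u \<bullet> u)\<^sup>2)"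
  let ?H = "\<lambda>h. 2 * p\<^sup>2 * (h \<bullet> w) + 4 * p * lam\<^sup>2 * (x \<bullet> h) * (x \<bullet> w)
    + lam ^ 4 * (12 * (x \<bullet> v)\<^sup>2 * (x \<bullet> h) * (x \<bullet> w) / (v \<bullet> v)
       - 8 * (x \<bullet> v) ^ 3 * (x \<bullet> w) * (v \<bullet> h) / (v \<bullet> v)\<^sup>2
       - 8 * (x \<bullet> v) ^ 3 * (x \<bullet> h) * (v \<bullet> w) / (v \<bullet> v)\<^sup>2
       - 2 * (x \<bullet> v) ^ 4 * (h \<bullet> w) / (v \<bullet> v)\<^sup>2
       + 8 * (x \<bullet> v) ^ 4 * (v \<bullet> w) * (v \<bullet> h) / (v \<bullet> v) ^ 3)"
  have F: "(?F has_derivative ?D u) (at u)" if "u \<noteq> 0" for u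
  proof -
    have "u \<bullet> u \<noteq> 0" using that by simp
    then show ?thesis unfolding phi_metric_sq p_def[symmetric]
      by (auto intro!: derivative_eq_intros simp: fun_eq_iff inner_commute)
        (simp add: field_simps power2_eq_square power3_eq_cube power4_eq_xxxx)
  qed
  have vv: "v \<bullet> v \<noteq> 0" using assms by simp
  have "((\<lambda>u. ?D u w) has_derivative ?H) (at v)"
    using vv
    by (auto intro!: derivative_eq_intros simp: fun_eq_iff inner_commute)
      (simp add: field_simps power2_eq_square power3_eq_cube power4_eq_xxxx)
  \<comment> \<open>The differential of \<open>?F\<close> has been identified with \<open>?D\<close>
    only off the origin, an open set containing \<open>v\<close>.\<close>
  then have "((\<lambda>u. frechet_derivative ?F (at u) w) has_derivative ?H) (at v)"
    by (rule has_derivative_transform_within_open[where s = "- {0}"])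
      (auto simp: assms frechet_derivative_at[OF F, symmetric])
  from fun_cong[OF frechet_derivative_at[OF this, symmetric], of w] show ?thesis
    unfolding hessian_def p_def[symmetric]
    by (simp add: algebra_simps power2_eq_square[of "x \<bullet> w"] power2_eq_square[of "v \<bullet> w"])
qed

text \<open>Of the coefficient 12, a part 8 completes the square \<open>(b - a * c / N)^2\<close>.
  The only negative term is absorbed by \<open>2 * p^2 * W\<close>, strictly, because
  \<open>lam^2 * a^2 / N\<close> is at most \<open>lam^2 * norm x ^ 2 = p - 1\<close>.\<close>

lemma hessian_phi_metric_sq_pos:
  assumes "v \<noteq> 0" "w \<noteq> 0"
  shows "hessian (\<lambda>u. (phi_metric lam (x, u))\<^sup>2) v w w > 0"
proof -
  define p a b c N W where defs: "p = 1 + lam\<^sup>2 * (norm x)\<^sup>2" "a = x \<bullet> v" "b = x \<bullet> w" "c = v \<bullet> w"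
    "N = v \<bullet> v" "W = w \<bullet> w"
  have N: "N > 0" and W: "W > 0" using assms by (auto simp: defs)
  have p: "p \<ge> 1" by (simp add: defs)
  have "hessian (\<lambda>u. (phi_metric lam (x, u))\<^sup>2) v w w =
      2 * p\<^sup>2 * W + 4 * p * lam\<^sup>2 * b\<^sup>2 + lam ^ 4 * (12 * a\<^sup>2 * b\<^sup>2 / N
       - 16 * a ^ 3 * b * c / N\<^sup>2 + 8 * a ^ 4 * c\<^sup>2 / N ^ 3 - 2 * a ^ 4 * W / N\<^sup>2)"
    using hessian_phi_metric_sq[OF assms(1)] by (simp add: defs)
  also have "\<dots> = 2 * W * (p\<^sup>2 - (lam\<^sup>2 * a\<^sup>2 / N)\<^sup>2) + 4 * p * lam\<^sup>2 * b\<^sup>2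
      + lam ^ 4 * (4 * a\<^sup>2 * b\<^sup>2 / N + 8 * a\<^sup>2 * (b - a * c / N)\<^sup>2 / N)"
    using N by (simp add: field_simps power2_eq_square power3_eq_cube power4_eq_xxxx)
  also have "\<dots> > 0"
  proof (intro add_pos_nonneg mult_pos_pos)
    have "a\<^sup>2 / N \<le> (norm x)\<^sup>2"
      using power2_inner_le[of x v] N by (simp add: defs pos_divide_le_eq power2_norm_eq_inner)
    then have "lam\<^sup>2 * (a\<^sup>2 / N) \<le> lam\<^sup>2 * (norm x)\<^sup>2"
      by (rule mult_left_mono) simp
    then have "lam\<^sup>2 * a\<^sup>2 / N < p" by (simp add: defs)
    then have "(lam\<^sup>2 * a\<^sup>2 / N)\<^sup>2 < p\<^sup>2"
      using N by (intro power_strict_mono) auto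
    then show "p\<^sup>2 - (lam\<^sup>2 * a\<^sup>2 / N)\<^sup>2 > 0" by simp
  qed (use N W p in auto)
  finally show ?thesis .
qed

lemma finsler_metric_phi_metric: "finsler_metric (phi_metric lam)"
  by (simp add: finsler_metric_def minkowski_norm_def continuous_on_phi_metric smooth_on_phi_metric
      smooth_on_phi_metric_fibre is_norm_phi_metric hessian_phi_metric_sq_pos)

section \<open>The area of the unit disc\<close>

lemma borel_measurable_vec2:
  "(\<lambda>(s, t). vector [s, t] :: real^2) \<in> borel_measurable borel"
proof -
  have "(\<lambda>(s, t). vector [s, t] :: real^2) = (\<lambda>z. fst z *\<^sub>R axis 1 1 + snd z *\<^sub>R axis 2 1)"
    by (auto simp: fun_eq_iff vec_eq_iff forall_2 axis_def)
  then show ?thesis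
    by (auto intro!: borel_measurable_continuous_onI continuous_intros)
qed

text \<open>Carries areas from \<open>real^2\<close>, where \<open>plane_lebesgue\<close> is
  formulated, to \<open>real \<times> real\<close>, where Fubini applies. The two measures are
  compared on boxes.\<close>

lemma distr_lborel_prod_vec2:
  "distr lborel borel (\<lambda>(s, t). vector [s, t]) = (lborel :: (real^2) measure)"
proof (rule lborel_eqI[symmetric])
  let ?f = "\<lambda>(s, t). vector [s, t] :: real^2"
  fix l u :: "real^2"
  assume lu: "\<And>b. b \<in> Basis \<Longrightarrow> l \<bullet> b \<le> u \<bullet> b"
  have "l $ 1 \<le> u $ 1" "l $ 2 \<le> u $ 2"
    using lu[of "axis 1 1"] lu[of "axis 2 1"] by (simp_all add: inner_axis)
  have "?f -` box l u = box (l $ 1) (u $ 1) \<times> box (l $ 2) (u $ 2)"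
    by (auto simp: box_def Basis_vec_def inner_axis forall_2)
  then have "emeasure (distr lborel borel ?f) (box l u)
      = emeasure (lborel \<Otimes>\<^sub>M lborel) (box (l $ 1) (u $ 1) \<times> box (l $ 2) (u $ 2))"
    using borel_measurable_vec2 by (simp add: emeasure_distr lborel_prod)
  also have "\<dots> = ennreal (u $ 1 - l $ 1) * ennreal (u $ 2 - l $ 2)"
    using \<open>l $ 1 \<le> u $ 1\<close> \<open>l $ 2 \<le> u $ 2\<close>
    by (simp add: lborel.emeasure_pair_measure_Times)
  finally show "emeasure (distr lborel borel ?f) (box l u) = (\<Prod>b\<in>Basis. (u - l) \<bullet> b)"
    using \<open>l $ 1 \<le> u $ 1\<close> \<open>l $ 2 \<le> u $ 2\<close>
    by (simp add: Basis_vec_def UNIV_2 inner_axis axis_eq_axis ennreal_mult mult.commute)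
qed simp

lemma nn_integral_abs_interval:
  fixes c :: real
  assumes "c \<ge> 0"
  shows "(\<integral>\<^sup>+s. ennreal \<bar>s\<bar> * indicator {- c..c} s \<partial>lborel) = ennreal (c\<^sup>2)"
proof -
  have "((\<lambda>s::real. s * \<bar>s\<bar> / 2) has_real_derivative \<bar>s\<bar>) (at s)" for s
  proof (cases "s = 0")
    case False
    then have "(abs has_real_derivative sgn s) (at s)"
      using has_derivative_norm[of s]
      by (simp add: has_field_derivative_def real_norm_def[abs_def] mult_commute_abs)
    from DERIV_cdivide[OF DERIV_mult[OF DERIV_ident this], of 2] show ?thesis
      by (simp add: abs_sgn)
  next
    case True
    \<comment> \<open>The product rule fails at 0, where \<open>abs\<close> is not differentiable;
      the difference quotient of the antiderivative is \<open>\<bar>h\<bar> / 2\<close>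
      there.\<close>
    have "((\<lambda>h::real. \<bar>h\<bar> / 2) \<longlongrightarrow> 0) (at 0)"
      by (auto intro!: tendsto_eq_intros)
    then have "((\<lambda>h::real. h * \<bar>h\<bar> / 2 / h) \<longlongrightarrow> 0) (at 0)"
      by (rule tendsto_cong[THEN iffD1, rotated]) (auto simp: eventually_at_filter)
    then show ?thesis using True by (simp add: DERIV_def)
  qed
  from nn_integral_FTC_Icc[of "\<lambda>s. \<bar>s\<bar>" "- c" c, OF _ this] show ?thesis
    using assms by (simp add: power2_eq_square)
qed

text \<open>An explicit antiderivative \<open>F\<close>, a rational term plus an arctangent,
  evaluates the integral over the positive half-line; evenness doubles it.\<close>

lemma nn_integral_rational:
  fixes P R :: real
  assumes "P > 0" "R > 0"
  shows "(\<integral>\<^sup>+u. ennreal ((1 + u\<^sup>2) / (R + P * u\<^sup>2)\<^sup>2) \<partial>lborel)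
    = ennreal (pi * (P + R) / (2 * (P * R) powr (3/2)))"
proof -
  \<comment> \<open>\<open>k\<close> is chosen so that \<open>1 + (k * u)^2\<close> is proportional
    to \<open>R + P * u^2\<close>. \<open>A\<close> and \<open>B\<close> come from comparing
    coefficients of 1 and \<open>u^2\<close> in the numerator of the derivative of
    \<open>F\<close>.\<close>
  define k where "k = sqrt (P / R)"
  define A where "A = (1 / R - 1 / P) / 2"
  define B where "B = (1 / R + 1 / P) / (2 * R * k)"
  have k: "k > 0" "k\<^sup>2 = P / R" using assms by (auto simp: k_def)
  have B: "B > 0" using assms k by (simp add: B_def add_pos_pos)
  define F where "F = (\<lambda>u. A * (u / (R + P * u\<^sup>2)) + B * arctan (k * u))"
  let ?f = "\<lambda>u. (1 + u\<^sup>2) / (R + P * u\<^sup>2)\<^sup>2"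
  have pos: "R + P * u\<^sup>2 > 0" for u using assms by (simp add: add_pos_nonneg)
  have D: "(F has_real_derivative ?f u) (at u)" for u
  proof -
    define D where "D = R + P * u\<^sup>2"
    have D0: "D > 0" using pos by (simp add: D_def)
    have k2: "1 + (k * u)\<^sup>2 = D / R"
      using k assms by (simp add: power_mult_distrib D_def field_simps)
    have "(F has_real_derivative A * ((D - u * (2 * P * u)) / D\<^sup>2) + B * (k / (1 + (k * u)\<^sup>2))) (at u)"
    proof -
      have "((\<lambda>u. u / (R + P * u\<^sup>2)) has_real_derivative (D - u * (2 * P * u)) / D\<^sup>2) (at u)"
        using pos[of u] unfolding D_def
        by (auto intro!: derivative_eq_intros simp: power2_eq_square)
      moreover have "((\<lambda>u. arctan (k * u)) has_real_derivative k / (1 + (k * u)\<^sup>2)) (at u)"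
        by (auto intro!: derivative_eq_intros simp: divide_inverse)
      ultimately show ?thesis unfolding F_def by (intro DERIV_add DERIV_cmult)
    qed
    also have "B * (k / (1 + (k * u)\<^sup>2)) = (1 / R + 1 / P) / (2 * D)"
      using k assms D0 unfolding k2 by (simp add: B_def)
    also have "A * ((D - u * (2 * P * u)) / D\<^sup>2) + (1 / R + 1 / P) / (2 * D)
        = (A * (D - 2 * P * u\<^sup>2) + (1 / R + 1 / P) / 2 * D) / D\<^sup>2"
      using D0 by (simp add: field_simps power2_eq_square)
    also have "A * (D - 2 * P * u\<^sup>2) + (1 / R + 1 / P) / 2 * D = 1 + u\<^sup>2"
      using assms by (simp add: A_def D_def field_simps)
    finally show ?thesis by (simp add: D_def)
  qed
  have bm: "?f \<in> borel_measurable borel" by measurable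
  have top: "(F \<longlongrightarrow> B * (pi / 2)) at_top"
  proof -
    have "((\<lambda>u. u / (R + P * u\<^sup>2)) \<longlongrightarrow> 0) at_top"
      using assms by real_asymp
    from tendsto_add[OF tendsto_mult_left[OF this, of A] tendsto_mult_left[of _ "pi / 2" _ B]]
    show ?thesis unfolding F_def
      using k by (auto intro!:  filterlim_compose[OF tendsto_arctan_at_top]
          filterlim_tendsto_pos_mult_at_top[OF tendsto_const] filterlim_ident)
  qed
  have half: "(\<integral>\<^sup>+u. ennreal (?f u) * indicator {0..} u \<partial>lborel) = ennreal (B * (pi / 2))"
    using nn_integral_FTC_atLeast[OF bm D _ top, of 0] by (simp add: F_def)
  have "(\<integral>\<^sup>+u. ennreal (?f u) * indicator {..0} u \<partial>lborel)
      = (\<integral>\<^sup>+u. ennreal (?f u) * indicator {0..} u \<partial>lborel)"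
    using nn_integral_real_affine[of "\<lambda>u. ennreal (?f u) * indicator {..0} u" "-1" 0]
    by (simp add: indicator_def cong: if_cong)
  then have "(\<integral>\<^sup>+u. ennreal (?f u) * indicator {0..} u + ennreal (?f u) * indicator {..0} u \<partial>lborel)
      = ennreal (B * (pi / 2)) + ennreal (B * (pi / 2))"
    using half by (subst nn_integral_add) auto
  also have "(\<integral>\<^sup>+u. ennreal (?f u) * indicator {0..} u + ennreal (?f u) * indicator {..0} u \<partial>lborel)
      = (\<integral>\<^sup>+u. ennreal (?f u) \<partial>lborel)"
    \<comment> \<open>The two half-lines overlap only in the null set \<open>{0}\<close>.\<close>
    using AE_lborel_singleton[of "0::real"]
    by (intro nn_integral_cong_AE) (auto elim!: eventually_mono split: split_indicator)
  also have "ennreal (B * (pi / 2)) + ennreal (B * (pi / 2)) = ennreal (B * pi)"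
    using B by (simp flip: ennreal_plus)
  also have "B * pi = pi * (P + R) / (2 * (P * R) powr (3/2))"
  proof -
    have "R * k = sqrt (P * R)"
      using assms by (simp add: k_def real_sqrt_divide real_sqrt_mult field_simps)
    moreover have "(P * R) powr (3/2) = (P * R) powr 1 * (P * R) powr (1/2)"
      by (subst powr_add[symmetric]) simp
    then have "(P * R) powr (3/2) = P * R * sqrt (P * R)"
      using assms by (simp add: powr_half_sqrt)
    ultimately show ?thesis using assms unfolding B_def mult.assoc
      by (simp add: field_simps)
  qed
  finally show ?thesis .
qed

text \<open>The substitution \<open>t = s u\<close> on the lines \<open>s = const\<close> replaces polar coordinates and makes the
  integrand rational.\<close>

lemma emeasure_planar_unit_disc:
  fixes P Q :: real
  assumes "P > 0" "Q \<ge> 0"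
  shows "emeasure lborel {z::real \<times> real. P * ((fst z)\<^sup>2 + (snd z)\<^sup>2) + Q * (fst z)\<^sup>2
        \<le> sqrt ((fst z)\<^sup>2 + (snd z)\<^sup>2)}
    = ennreal (pi * (2 * P + Q) / (2 * (P * (P + Q)) powr (3/2)))"
    (is "emeasure _ ?S = _")
proof -
  let ?I = "indicator ?S :: real \<times> real \<Rightarrow> ennreal"
  have S: "?S \<in> sets borel"
    by (intro borel_closed closed_Collect_le continuous_intros)
  have IS: "?I \<in> borel_measurable borel" using S by simp
  \<comment> \<open>The line of slope \<open>u\<close> through the origin meets the disc exactly
    where \<open>\<bar>s\<bar>\<close> is at most \<open>c u\<close>.\<close>
  define c where "c = (\<lambda>u::real. sqrt (1 + u\<^sup>2) / (P + Q + P * u\<^sup>2))"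
  have den: "P + Q + P * u\<^sup>2 > 0" for u using assms by (simp add: add_pos_nonneg)
  have c0: "c u \<ge> 0" for u using den[of u] by (simp add: c_def)
  have mem: "(s, s * u) \<in> ?S \<longleftrightarrow> s \<in> {- c u..c u}" if "s \<noteq> 0" for s u
  proof -
    have "sqrt (s\<^sup>2 + (s * u)\<^sup>2) = \<bar>s\<bar> * sqrt (1 + u\<^sup>2)"
    proof -
      have "s\<^sup>2 + (s * u)\<^sup>2 = s\<^sup>2 * (1 + u\<^sup>2)" by (simp add: algebra_simps)
      then show ?thesis by (simp add: real_sqrt_mult)
    qed
    moreover have "P * (s\<^sup>2 + (s * u)\<^sup>2) + Q * s\<^sup>2 = \<bar>s\<bar> * (\<bar>s\<bar> * (P + Q + P * u\<^sup>2))"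
      by (simp add: algebra_simps power2_eq_square abs_mult_self_eq flip: abs_mult)
    ultimately have "(s, s * u) \<in> ?S \<longleftrightarrow> \<bar>s\<bar> * (\<bar>s\<bar> * (P + Q + P * u\<^sup>2)) \<le> \<bar>s\<bar> * sqrt (1 + u\<^sup>2)"
      by simp
    also have "\<dots> \<longleftrightarrow> \<bar>s\<bar> * (P + Q + P * u\<^sup>2) \<le> sqrt (1 + u\<^sup>2)"
      using that by (intro mult_le_cancel_left_pos) simp
    also have "\<dots> \<longleftrightarrow> \<bar>s\<bar> \<le> c u"
      using den[of u] by (simp add: c_def pos_le_divide_eq)
    finally show ?thesis by auto
  qed
  have "emeasure lborel ?S = (\<integral>\<^sup>+z. ?I z \<partial>(lborel \<Otimes>\<^sub>M lborel))"
    using S by (simp add: lborel_prod)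
  also have "\<dots> = (\<integral>\<^sup>+s. \<integral>\<^sup>+t. ?I (s, t) \<partial>lborel \<partial>lborel)"
    using IS by (subst lborel.nn_integral_fst) (simp_all add: lborel_prod)
  also have "\<dots> = (\<integral>\<^sup>+s. \<integral>\<^sup>+u. ennreal \<bar>s\<bar> * indicator {- c u..c u} s \<partial>lborel \<partial>lborel)"
  \<comment> \<open>The null line \<open>s = 0\<close> is dropped: both the substitution, with
    Jacobian \<open>\<bar>s\<bar>\<close>, and the cancellation in \<open>mem\<close> require
    \<open>s\<close> nonzero.\<close>
  proof (rule nn_integral_cong_AE, rule eventually_mono[OF AE_lborel_singleton[of 0]])
    fix s :: real assume s: "s \<noteq> 0"
    have ms: "(\<lambda>t. ?I (s, t)) \<in> borel_measurable borel"
      using IS by (rule measurable_compose[rotated]) measurable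
    then have m: "(\<lambda>u. ?I (s, s * u)) \<in> borel_measurable borel"
      by (rule measurable_compose[rotated]) measurable
    have "(\<integral>\<^sup>+t. ?I (s, t) \<partial>lborel) = ennreal \<bar>s\<bar> * (\<integral>\<^sup>+u. ?I (s, s * u) \<partial>lborel)"
      using nn_integral_real_affine[OF ms s, of 0] by simp
    also have "\<dots> = (\<integral>\<^sup>+u. ennreal \<bar>s\<bar> * ?I (s, s * u) \<partial>lborel)"
      using m by (simp add: nn_integral_cmult)
    also have "(\<lambda>u. ?I (s, s * u)) = (\<lambda>u. indicator {- c u..c u} s)"
      using mem[OF s] by (simp add: fun_eq_iff indicator_def)
    finally show "(\<integral>\<^sup>+t. ?I (s, t) \<partial>lborel) = (\<integral>\<^sup>+u. ennreal \<bar>s\<bar> * indicator {- c u..c u} s \<partial>lborel)"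
      by (simp add: fun_eq_iff)
  qed
  also have "\<dots> = (\<integral>\<^sup>+u. \<integral>\<^sup>+s. ennreal \<bar>s\<bar> * indicator {- c u..c u} s \<partial>lborel \<partial>lborel)"
  proof (rule lborel_pair.Fubini'[symmetric])
    have "(\<lambda>z::real \<times> real. ennreal \<bar>fst z\<bar> * indicator {z. - c (snd z) \<le> fst z \<and> fst z \<le> c (snd z)} z)
        \<in> borel_measurable borel"
    proof (rule borel_measurable_times_ennreal)
      show "(\<lambda>z::real \<times> real. ennreal \<bar>fst z\<bar>) \<in> borel_measurable borel"
        by (intro measurable_compose[OF _ measurable_ennreal] borel_measurable_continuous_onI
            continuous_intros)
      have "{z. - c (snd z) \<le> fst z \<and> fst z \<le> c (snd z)} \<in> sets borel"
        unfolding c_def using den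
        by (intro borel_closed closed_Collect_conj closed_Collect_le continuous_intros) (auto simp: less_le)
      then show "(indicator {z. - c (snd z) \<le> fst z \<and> fst z \<le> c (snd z)} :: _ \<Rightarrow> ennreal) \<in> borel_measurable borel"
        by simp
    qed
    then show "(\<lambda>(s, u). ennreal \<bar>s\<bar> * indicator {- c u..c u} s) \<in> borel_measurable (lborel \<Otimes>\<^sub>M lborel)"
      by (simp add: lborel_prod case_prod_beta' indicator_def)
  qed
  \<comment> \<open>With \<open>s\<close> now the inner variable, the inner integral is
    \<open>(c u)^2\<close>, in which the square root disappears.\<close>
  also have "\<dots> = (\<integral>\<^sup>+u. ennreal ((1 + u\<^sup>2) / ((P + Q) + P * u\<^sup>2)\<^sup>2) \<partial>lborel)"
    using nn_integral_abs_interval[OF c0] by (simp add: c_def power_divide)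
  also have "\<dots> = ennreal (pi * (2 * P + Q) / (2 * (P * (P + Q)) powr (3/2)))"
    using nn_integral_rational[of P "P + Q"] assms by simp
  finally show ?thesis .
qed

section \<open>Reduction of the plane section to planar coordinates\<close>

text \<open>Take \<open>e1\<close> along the projection \<open>y\<close> of \<open>x\<close> to the
  plane orthogonal to \<open>n\<close>, and \<open>e2 = cross3 n e1\<close>. Then \<open>x\<close>
  has no \<open>e2\<close> component, and Pythagoras gives the component along
  \<open>e1\<close>.\<close>

lemma orthonormal_frame_of_plane:
  fixes n x :: "real^3"
  assumes "norm n = 1"
  obtains e1 e2 where "norm e1 = 1" "norm e2 = 1" "e1 \<bullet> e2 = 0" "cross3 e1 e2 = n"
    "x \<bullet> e2 = 0" "(x \<bullet> e1)\<^sup>2 = (norm x)\<^sup>2 - (x \<bullet> n)\<^sup>2"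
proof -
  have nn: "n \<bullet> n = 1" using assms by (simp add: dot_square_norm)
  define y where "y = x - (x \<bullet> n) *\<^sub>R n"
  have yn: "y \<bullet> n = 0" by (simp add: y_def inner_diff_left nn)
  obtain e1 where e1: "norm e1 = 1" "e1 \<bullet> n = 0" "y = norm y *\<^sub>R e1"
  proof (cases "y = 0")
    case True
    \<comment> \<open>If \<open>x\<close> is parallel to \<open>n\<close>, any unit vector of the
      plane serves as \<open>e1\<close>.\<close>
    obtain z where "z \<noteq> 0" "orthogonal n z"
      using orthogonal_to_vector_exists[of n] by auto
    then show ?thesis using that[of "sgn z"] True
      by (simp add: norm_sgn sgn_div_norm orthogonal_def inner_commute)
  next
    case False
    then show ?thesis using that[of "sgn y"] yn by (simp add: norm_sgn sgn_div_norm)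
  qed
  have ee: "e1 \<bullet> e1 = 1" using e1 by (simp add: dot_square_norm)
  define e2 where "e2 = cross3 n e1"
  have x: "x = (x \<bullet> n) *\<^sub>R n + norm y *\<^sub>R e1" using e1(3) by (simp add: y_def)
  show thesis
  proof
    show "norm e1 = 1" by fact
    have "(norm e2)\<^sup>2 = 1"
      using norm_cross[of n e1] assms e1 by (simp add: e2_def inner_commute)
    then show "norm e2 = 1" using norm_ge_zero[of e2] by (simp add: power2_eq_1_iff)
    show "e1 \<bullet> e2 = 0" by (simp add: e2_def dot_cross_self)
    show "cross3 e1 e2 = n" using ee e1(2) by (simp add: e2_def Lagrange)
    show "x \<bullet> e2 = 0"
      by (subst x) (simp add: inner_add_left e2_def dot_cross_self)
    have "x \<bullet> e1 = norm y"
      by (subst x) (simp add: inner_add_left ee e1(2) inner_commute[of n])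
    moreover have "(norm y)\<^sup>2 = (norm x)\<^sup>2 - (x \<bullet> n)\<^sup>2"
      unfolding power2_norm_eq_inner y_def
      by (simp add: inner_diff_left inner_diff_right nn inner_commute power2_eq_square)
    ultimately show "(x \<bullet> e1)\<^sup>2 = (norm x)\<^sup>2 - (x \<bullet> n)\<^sup>2" by simp
  qed
qed

text \<open>The parametrisation always lands in the span, so the intersection disappears on pulling
  back; a second pullback passes from \<open>real^2\<close> to pairs.\<close>

lemma measure_plane_lebesgue:
  assumes "S \<in> sets borel"
  shows "measure (plane_lebesgue v w) (S \<inter> span {v, w})
    = measure lborel {z. fst z *\<^sub>R v + snd z *\<^sub>R w \<in> S}"
proof -
  let ?g = "\<lambda>t::real^2. t$1 *\<^sub>R v + t$2 *\<^sub>R w"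
  let ?h = "\<lambda>(s, t). vector [s, t] :: real^2"
  let ?N = "restrict_space borel (span {v, w})"
  have sp: "?g t \<in> span {v, w}" for t
    by (intro span_add span_scale span_base) auto
  moreover have "?g \<in> borel_measurable borel"
    by (intro borel_measurable_continuous_onI continuous_intros)
  ultimately have gm: "?g \<in> lborel \<rightarrow>\<^sub>M ?N"
    by (intro measurable_restrict_space2) auto
  have gS: "?g -` S \<in> sets borel"
    using measurable_sets[OF \<open>?g \<in> borel_measurable borel\<close> assms] by simp
  have "S \<inter> span {v, w} \<in> sets ?N"
    using assms by (auto simp: sets_restrict_space)
  then have "measure (plane_lebesgue v w) (S \<inter> span {v, w}) = measure lborel (?g -` S)"
    using sp unfolding plane_lebesgue_def
    by (subst measure_distr[OF gm]) (auto intro!: arg_cong[of _ _ "measure lborel"])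
  also have "\<dots> = measure lborel (?h -` (?g -` S))"
    using borel_measurable_vec2 gS by (subst distr_lborel_prod_vec2[symmetric]) (simp add: measure_distr)
  also have "?h -` (?g -` S) = {z. fst z *\<^sub>R v + snd z *\<^sub>R w \<in> S}"
    by auto
  finally show ?thesis .
qed

text \<open>The vector has norm \<open>c * r\<close> with \<open>r = sqrt (s^2 + t^2)\<close>, and
  its inner product with \<open>x\<close> is \<open>c * s * (x \<bullet> e1)\<close>. Multiplying
  the inequality by \<open>r\<close> clears the denominator; at the origin both sides hold, the left
  one through division by zero.\<close>

lemma phi_metric_le_1_iff:
  fixes x e1 e2 :: "real^3"
  assumes "norm e1 = 1" "norm e2 = 1" "e1 \<bullet> e2 = 0" "x \<bullet> e2 = 0" "c > 0"
  shows "phi_metric lam (x, s *\<^sub>R c *\<^sub>R e1 + t *\<^sub>R c *\<^sub>R e2) \<le> 1 \<longleftrightarrow>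
    c * (1 + lam\<^sup>2 * (norm x)\<^sup>2) * (s\<^sup>2 + t\<^sup>2) + c * (lam\<^sup>2 * (x \<bullet> e1)\<^sup>2) * s\<^sup>2 \<le> sqrt (s\<^sup>2 + t\<^sup>2)"
proof -
  define p q r where "p = 1 + lam\<^sup>2 * (norm x)\<^sup>2" "q = lam\<^sup>2 * (x \<bullet> e1)\<^sup>2" "r = sqrt (s\<^sup>2 + t\<^sup>2)"
  note defs = this
  let ?u = "s *\<^sub>R c *\<^sub>R e1 + t *\<^sub>R c *\<^sub>R e2"
  have r2: "r\<^sup>2 = s\<^sup>2 + t\<^sup>2" by (simp add: defs)
  have ee: "e1 \<bullet> e1 = 1" "e2 \<bullet> e2 = 1" "e2 \<bullet> e1 = 0"
    using assms by (simp_all add: dot_square_norm inner_commute)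
  have "?u \<bullet> ?u = (c * r)\<^sup>2"
    using assms(3) ee unfolding power_mult_distrib r2
    by (simp add: inner_add_left inner_add_right power2_eq_square algebra_simps)
  then have u: "norm ?u = c * r"
    using assms(5) by (simp add: norm_eq_sqrt_inner defs)
  have xu: "x \<bullet> ?u = c * s * (x \<bullet> e1)"
    using assms(4) by (simp add: inner_add_right)
  show ?thesis
  proof (cases "r = 0")
    case True
    then have "s = 0" "t = 0" by (auto simp: defs sum_power2_eq_zero_iff)
    then show ?thesis by (simp add: phi_metric_def)
  next
    case False
    then have r: "r > 0" by (simp add: defs less_le)
    have "phi_metric lam (x, ?u) = (p * (c * r)\<^sup>2 + lam\<^sup>2 * (c * s * (x \<bullet> e1))\<^sup>2) / (c * r)"
      by (simp only: phi_metric_def prod.case u xu defs(1))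
    also have "\<dots> = (c * p * r\<^sup>2 + c * q * s\<^sup>2) / r"
      using assms(5) r by (simp add: defs(2) power_mult_distrib field_simps)
        (simp add: power2_eq_square)
    finally show ?thesis using r r2 by (simp add: defs)
  qed
qed

text \<open>Makes the unit ball a Borel set, as \<open>measure_plane_lebesgue\<close>
  requires.\<close>

lemma closed_phi_metric_ball: "closed {u. phi_metric lam (x, u) \<le> 1}"
proof -
  have "continuous_on UNIV (\<lambda>u. phi_metric lam (x, u))"
    using continuous_on_phi_metric
    by (rule continuous_on_compose2) (auto intro!: continuous_intros)
  then show ?thesis by (intro closed_Collect_le) auto
qed

lemma powr_three_halves: "A \<ge> 0 \<Longrightarrow> A powr (3/2) = A * sqrt A" for A :: real
  using powr_add[of A 1 "1/2"] by (simp add: powr_half_sqrt)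

section \<open>Evaluation of the area integrand\<close>

lemma hausdorff_area_integrand_phi_metric:
  fixes x a :: "real^3"
  assumes "a \<noteq> 0"
  shows "hausdorff_area_integrand (phi_metric lam) x a =
    2 * (1 + lam\<^sup>2 * (norm x)\<^sup>2) powr (3/2)
      * ((1 + 2 * lam\<^sup>2 * (norm x)\<^sup>2) * (norm a)\<^sup>2 - lam\<^sup>2 * (x \<bullet> a)\<^sup>2) powr (3/2)
      / ((2 + 3 * lam\<^sup>2 * (norm x)\<^sup>2) * (norm a)\<^sup>2 - lam\<^sup>2 * (x \<bullet> a)\<^sup>2)"
proof -
  define A where "A = norm a"
  define n where "n = sgn a"
  have A: "A > 0" and an: "a = A *\<^sub>R n" and n: "norm n = 1"
    using assms by (auto simp: A_def n_def sgn_div_norm)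
  obtain e1 e2 where e: "norm e1 = 1" "norm e2 = 1" "e1 \<bullet> e2 = 0" "cross3 e1 e2 = n"
    "x \<bullet> e2 = 0" "(x \<bullet> e1)\<^sup>2 = (norm x)\<^sup>2 - (x \<bullet> n)\<^sup>2"
    using orthonormal_frame_of_plane[OF n] .
  have xa: "x \<bullet> a = A * (x \<bullet> n)" by (simp add: an)
  \<comment> \<open>Scaling both frame vectors by \<open>c = sqrt A\<close> turns their cross
    product \<open>n\<close> into \<open>a\<close>. The section becomes the planar disc with
    parameters \<open>c * p\<close> and \<open>c * q\<close>.\<close>
  define p q c where defs: "p = 1 + lam\<^sup>2 * (norm x)\<^sup>2" "q = lam\<^sup>2 * (x \<bullet> e1)\<^sup>2" "c = sqrt A"
  have c: "c > 0" "c * c = A" using A by (simp_all add: defs)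
  have p: "p > 0" "q \<ge> 0" by (simp_all add: defs add_pos_nonneg)
  let ?v = "c *\<^sub>R e1" and ?w = "c *\<^sub>R e2"
  have vw: "cross3 ?v ?w = a"
    using c an e(4) by (simp add: cross_mult_left cross_mult_right)
  let ?B = "{u. phi_metric lam (x, u) \<le> 1}"
  have "measure (plane_lebesgue ?v ?w) (?B \<inter> span {?v, ?w})
      = measure lborel {z. fst z *\<^sub>R ?v + snd z *\<^sub>R ?w \<in> ?B}"
    by (intro measure_plane_lebesgue borel_closed closed_phi_metric_ball)
  also have "{z. fst z *\<^sub>R ?v + snd z *\<^sub>R ?w \<in> ?B}
      = {z. c * p * ((fst z)\<^sup>2 + (snd z)\<^sup>2) + c * q * (fst z)\<^sup>2 \<le> sqrt ((fst z)\<^sup>2 + (snd z)\<^sup>2)}"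
    using phi_metric_le_1_iff[OF e(1-3,5) c(1), of lam] by (simp add: defs)
  also have "measure lborel \<dots> = pi * (2 * (c * p) + c * q) / (2 * (c * p * (c * p + c * q)) powr (3/2))"
    using emeasure_planar_unit_disc[of "c * p" "c * q"] c p unfolding measure_def by simp
  also have "\<dots> = pi * (c * (2 * p + q)) / (2 * (A * (p * (p + q))) powr (3/2))"
    unfolding c(2)[symmetric] by (simp add: algebra_simps)
  finally have "hausdorff_area_integrand (phi_metric lam) x a
      = 2 * (A * (p * (p + q))) powr (3/2) / (c * (2 * p + q))"
    using hausdorff_area_integrand_cross3[of ?v ?w "phi_metric lam" x] assms
    unfolding vw by simp
  \<comment> \<open>Both forms have degree one in \<open>A\<close>: on the left \<open>c\<close>
    cancels from \<open>A * c\<close>, on the right \<open>(A^2) powr (3/2) / A^2\<close> equals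
    \<open>A\<close>.\<close>
  also have "\<dots> = 2 * p powr (3/2) * ((p + q) * A\<^sup>2) powr (3/2) / ((2 * p + q) * A\<^sup>2)"
  proof -
    have "(A * (p * (p + q))) powr (3/2) = A * c * (p * (p + q)) powr (3/2)"
      using A p by (simp add: powr_mult powr_three_halves[of A] defs)
    moreover have "((p + q) * A\<^sup>2) powr (3/2) = (p + q) powr (3/2) * (A\<^sup>2 * A)"
      using A p by (simp add: powr_mult powr_three_halves[of "A\<^sup>2"])
    moreover have "(p * (p + q)) powr (3/2) = p powr (3/2) * (p + q) powr (3/2)"
      using p by (simp add: powr_mult)
    ultimately show ?thesis using A c(1) p
      by (simp add: power2_eq_square)
  qed
  \<comment> \<open>By the choice of frame,
    \<open>q = lam^2 * (norm x ^ 2 - (x \<bullet> n)^2)\<close>, while \<open>x \<bullet> a\<close>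
    is \<open>A * (x \<bullet> n)\<close>.\<close>
  also have "(p + q) * A\<^sup>2 = (1 + 2 * lam\<^sup>2 * (norm x)\<^sup>2) * (norm a)\<^sup>2 - lam\<^sup>2 * (x \<bullet> a)\<^sup>2"
    unfolding xa defs(1,2) e(6) A_def[symmetric] by (simp add: algebra_simps power2_eq_square)
  also have "(2 * p + q) * A\<^sup>2 = (2 + 3 * lam\<^sup>2 * (norm x)\<^sup>2) * (norm a)\<^sup>2 - lam\<^sup>2 * (x \<bullet> a)\<^sup>2"
    unfolding xa defs(1,2) e(6) A_def[symmetric] by (simp add: algebra_simps power2_eq_square)
  finally show ?thesis by (simp only: defs)
qed

theorem theorem3p5:
  fixes lam :: real
  shows "finsler_metric (phi_metric lam) \<and>
    (\<forall>(x::real^3) (a::real^3). a \<noteq> 0 \<longrightarrow>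
      hausdorff_area_integrand (phi_metric lam) x a =
        2 * (1 + lam\<^sup>2 * (norm x)\<^sup>2) powr (3/2)
          * ((1 + 2 * lam\<^sup>2 * (norm x)\<^sup>2) * (norm a)\<^sup>2 - lam\<^sup>2 * (x \<bullet> a)\<^sup>2) powr (3/2)
          / ((2 + 3 * lam\<^sup>2 * (norm x)\<^sup>2) * (norm a)\<^sup>2 - lam\<^sup>2 * (x \<bullet> a)\<^sup>2))"
  using finsler_metric_phi_metric hausdorff_area_integrand_phi_metric by blast

end
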